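(* If $(X,\lambda)$ is an approach space, then $\lambda_{lK}$ is an approach structure on $\mathcal{C}_{c(\lambda)}$, i.e. $(\mathcal{C}_{c(\lambda)},\lambda_{lK})$ is an approach space.
   Context: $\mathbb{F}X$ is the set of (proper) filters on a set $X$, $\mathbb{P}X$ the powerset. For filters, $\mathcal{F}\leq\mathcal{G}$ means $\mathcal{F}\subset\mathcal{G}$. For a family $\mathcal{A}\subset\mathbb{P}X$, its grill is $\mathcal{A}^{\#}=\{B\subset X:\forall A\in\mathcal{A},\ A\cap B\neq\emptyset\}$, and $\mathcal{A}\#\mathcal{B}$ means $\mathcal{A}\subset\mathcal{B}^{\#}$; $\{x\}^{\uparrow}$ is the principal ultrafilter of $x$. A convergence approach space is a set $X$ with $\lambda:\mathbb{F}X\to[0,\infty]^{X}$ such that $\mathcal{F}\leq\mathcal{G}$ implies $\lambda(\mathcal{F})\geq\lambda(\mathcal{G})$ pointwise, and $\lambda(\{x\}^{\uparrow})(x)=0$ for all $x\in X$. It is a pre-approach space if $\lambda(\bigcap_{\mathcal{D}\in\mathbb{D}}\mathcal{D})=\bigvee_{\mathcal{D}\in\mathbb{D}}\lambda(\mathcal{D})$ (pointwise) for every (nonempty) $\mathbb{D}\subset\mathbb{F}X$. For a family $\mathcal{F}\subset\mathbb{P}X$, the adherence function is $\operatorname{adh}_\lambda\mathcal{F}(x)=\bigwedge\{\lambda(\mathcal{G})(x):\mathcal{G}\in\mathbb{F}X,\ \mathcal{G}\#\mathcal{F}\}$ (infimum of $\emptyset$ is $\infty$); for $A\subset X$, $\operatorname{adh}_\lambda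 A=\operatorname{adh}_\lambda\{A\}$ and $A^{(\epsilon)}=\{x\in X:\operatorname{adh}_\lambda A(x)\leq\epsilon\}$. An approach space is a pre-approach space such that $\operatorname{adh}_\lambda A\leq\operatorname{adh}_\lambda A^{(\epsilon)}+\epsilon$ for every $A\subset X$ and $\epsilon\in[0,\infty]$. The convergence $c(\lambda)$ on $X$ is defined by $x\in\lim_{c(\lambda)}\mathcal{F}\iff\lambda(\mathcal{F})(x)=0$. A subset $A$ is closed for a convergence if $A\in\mathcal{F}$ implies $\lim\mathcal{F}\subset A$ for every filter $\mathcal{F}$. $\mathcal{C}_{c(\lambda)}$ is the set of $c(\lambda)$-closed subsets of $X$ (including $\emptyset$). For a family $\mathfrak{F}$ of subsets of $\mathcal{C}_{c(\lambda)}$, $\operatorname{rdc}\mathfrak{F}=\{\bigcup_{C\in\mathcal{A}}C:\mathcal{A}\in\mathfrak{F}\}$. For a filter $\mathfrak{F}$ on $\mathcal{C}_{c(\lambda)}$, $\mathfrak{F}^{\#}$ is its grill in $\mathcal{C}_{c(\lambda)}$, and for $A\in\mathcal{C}_{c(\lambda)}$, $$\lambda_{lK}\mathfrak{F}(A)=\bigvee_{x\in A}\operatorname{adh}_\lambda(\operatorname{rdc}(\mathfrak{F}^{\#}))(x)$$ (supremum of $\emptyset$ is $0$). *)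

theory Defs
  imports "HOL-Library.Extended_Nonnegative_Real"
begin

text \<open>Filters on a set \<open>X\<close> are rendered by the library type of filters: a proper filter on \<open>X\<close>
  is a filter different from \<open>bot\<close> that lies below \<open>principal X\<close>. The library order is the reverse
  of inclusion of filters, so coarser filters are larger, the intersection of a set of filters is
  its \<open>Sup\<close>, and the principal ultrafilter of \<open>x\<close> is \<open>principal {x}\<close>. The lemmas below relate
  this to filters as families of subsets of \<open>X\<close>.\<close>

definition filters_on :: "'a set \<Rightarrow> 'a filter set" where
  "filters_on X = {F. F \<noteq> bot \<and> F \<le> principal X}"

definition fsets :: "'a set \<Rightarrow> 'a filter \<Rightarrow> 'a set set" where
  "fsets X F = {A. A \<subseteq> X \<and> eventually (\<lambda>x. x \<in> A) F}"

lemma eventually_iff_fsets: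
  assumes "F \<le> principal X"
  shows "eventually P F \<longleftrightarrow> {x\<in>X. P x} \<in> fsets X F"
proof -
  have "eventually (\<lambda>x. x \<in> X) F"
    using assms by (simp add: le_principal)
  then show ?thesis
    by (auto simp: fsets_def eventually_conj_iff)
qed

lemma le_iff_fsets:
  assumes "F \<le> principal X" "G \<le> principal X"
  shows "G \<le> F \<longleftrightarrow> fsets X F \<subseteq> fsets X G"
proof
  show "G \<le> F \<Longrightarrow> fsets X F \<subseteq> fsets X G"
    by (auto simp: fsets_def le_filter_def)
  show "fsets X F \<subseteq> fsets X G \<Longrightarrow> G \<le> F"
    unfolding le_filter_def eventually_iff_fsets[OF assms(1)] eventually_iff_fsets[OF assms(2)]
    by blast
qed

lemma fsets_Sup: "D \<noteq> {} \<Longrightarrow> fsets X (Sup D) = (\<Inter>F\<in>D. fsets X F)"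
  by (auto simp: fsets_def eventually_Sup)

lemma fsets_principal: "fsets X (principal {x}) = {A. A \<subseteq> X \<and> x \<in> A}"
  by (auto simp: fsets_def eventually_principal)

text \<open>The families of the form \<open>fsets X F\<close> with \<open>F\<close> in \<open>filters_on X\<close> are exactly the proper
  filters on \<open>X\<close> in the sense of families of subsets.\<close>

lemma fsets_image_filters_on:
  "fsets X ` filters_on X =
    {\<F>. \<F> \<subseteq> Pow X \<and> X \<in> \<F> \<and> {} \<notin> \<F> \<and> (\<forall>A\<in>\<F>. \<forall>B\<in>\<F>. A \<inter> B \<in> \<F>) \<and>
        (\<forall>A\<in>\<F>. \<forall>B. A \<subseteq> B \<and> B \<subseteq> X \<longrightarrow> B \<in> \<F>)}" (is "_ = ?R")
proof (intro equalityI subsetI)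
  fix \<F> assume "\<F> \<in> fsets X ` filters_on X"
  then obtain F where F: "F \<noteq> bot" "F \<le> principal X" "\<F> = fsets X F"
    by (auto simp: filters_on_def)
  then show "\<F> \<in> ?R"
    by (auto simp: fsets_def le_principal trivial_limit_def eventually_conj_iff
        elim: eventually_mono)
next
  fix \<F> assume "\<F> \<in> ?R"
  then have R: "\<F> \<subseteq> Pow X" "X \<in> \<F>" "{} \<notin> \<F>" "\<And>A B. A \<in> \<F> \<Longrightarrow> B \<in> \<F> \<Longrightarrow> A \<inter> B \<in> \<F>"
    "\<And>A B. A \<in> \<F> \<Longrightarrow> A \<subseteq> B \<Longrightarrow> B \<subseteq> X \<Longrightarrow> B \<in> \<F>"
    by auto
  define F where "F = Abs_filter (\<lambda>P. {x\<in>X. P x} \<in> \<F>)"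
  have "is_filter (\<lambda>P. {x\<in>X. P x} \<in> \<F>)"
  proof
    show "{x\<in>X. True} \<in> \<F>"
      using R(2) by simp
    show "{x\<in>X. P x \<and> Q x} \<in> \<F>" if "{x\<in>X. P x} \<in> \<F>" "{x\<in>X. Q x} \<in> \<F>" for P Q
    proof -
      have "{x\<in>X. P x \<and> Q x} = {x\<in>X. P x} \<inter> {x\<in>X. Q x}" by auto
      then show ?thesis using R(4) that by simp
    qed
    show "{x\<in>X. Q x} \<in> \<F>" if "\<forall>x. P x \<longrightarrow> Q x" "{x\<in>X. P x} \<in> \<F>" for P Q
      by (rule R(5)[OF that(2)]) (use that(1) in auto)
  qed
  then have ev: "eventually P F \<longleftrightarrow> {x\<in>X. P x} \<in> \<F>" for P
    unfolding F_def by (rule eventually_Abs_filter)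
  have "F \<noteq> bot" "F \<le> principal X"
    using R(2,3) by (auto simp: trivial_limit_def le_principal ev)
  moreover have "{x\<in>X. x \<in> A} = A" if "A \<subseteq> X" for A
    using that by auto
  then have "fsets X F = \<F>"
    using R(1) by (auto simp: fsets_def ev)
  ultimately show "\<F> \<in> fsets X ` filters_on X"
    by (auto simp: filters_on_def)
qed

definition grill :: "'a set \<Rightarrow> 'a set set \<Rightarrow> 'a set set" where
  "grill X \<A> = {B. B \<subseteq> X \<and> (\<forall>A\<in>\<A>. A \<inter> B \<noteq> {})}"

definition mesh :: "'a set \<Rightarrow> 'a set set \<Rightarrow> 'a set set \<Rightarrow> bool" where
  "mesh X \<A> \<B> \<longleftrightarrow> \<A> \<subseteq> grill X \<B>"

text \<open>In what follows, \<open>lam F x\<close> is only relevant for \<open>F \<in> filters_on X\<close> and \<open>x \<in> X\<close>.\<close>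

definition convergence_approach_space :: "'a set \<Rightarrow> ('a filter \<Rightarrow> 'a \<Rightarrow> ennreal) \<Rightarrow> bool" where
  "convergence_approach_space X lam \<longleftrightarrow>
    (\<forall>F\<in>filters_on X. \<forall>G\<in>filters_on X. G \<le> F \<longrightarrow> (\<forall>x\<in>X. lam F x \<ge> lam G x)) \<and>
    (\<forall>x\<in>X. lam (principal {x}) x = 0)"

definition pre_approach_space :: "'a set \<Rightarrow> ('a filter \<Rightarrow> 'a \<Rightarrow> ennreal) \<Rightarrow> bool" where
  "pre_approach_space X lam \<longleftrightarrow>
    convergence_approach_space X lam \<and>
    (\<forall>D. D \<noteq> {} \<and> D \<subseteq> filters_on X \<longrightarrow> (\<forall>x\<in>X. lam (Sup D) x = (SUP F\<in>D. lam F x)))"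

definition adh :: "'a set \<Rightarrow> ('a filter \<Rightarrow> 'a \<Rightarrow> ennreal) \<Rightarrow> 'a set set \<Rightarrow> 'a \<Rightarrow> ennreal" where
  "adh X lam \<F> x = (INF G\<in>{G \<in> filters_on X. mesh X (fsets X G) \<F>}. lam G x)"

definition enlargement ::
    "'a set \<Rightarrow> ('a filter \<Rightarrow> 'a \<Rightarrow> ennreal) \<Rightarrow> 'a set \<Rightarrow> ennreal \<Rightarrow> 'a set" where
  "enlargement X lam A \<epsilon> = {x\<in>X. adh X lam {A} x \<le> \<epsilon>}"

definition approach_space :: "'a set \<Rightarrow> ('a filter \<Rightarrow> 'a \<Rightarrow> ennreal) \<Rightarrow> bool" where
  "approach_space X lam \<longleftrightarrow>
    pre_approach_space X lam \<and>
    (\<forall>A \<epsilon>. A \<subseteq> X \<longrightarrow>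
      (\<forall>x\<in>X. adh X lam {A} x \<le> adh X lam {enlargement X lam A \<epsilon>} x + \<epsilon>))"

definition conv_lim :: "'a set \<Rightarrow> ('a filter \<Rightarrow> 'a \<Rightarrow> ennreal) \<Rightarrow> 'a filter \<Rightarrow> 'a set" where
  "conv_lim X lam F = {x\<in>X. lam F x = 0}"

definition conv_closed :: "'a set \<Rightarrow> ('a filter \<Rightarrow> 'a set) \<Rightarrow> 'a set \<Rightarrow> bool" where
  "conv_closed X L A \<longleftrightarrow> A \<subseteq> X \<and> (\<forall>F\<in>filters_on X. A \<in> fsets X F \<longrightarrow> L F \<subseteq> A)"

definition closed_subsets :: "'a set \<Rightarrow> ('a filter \<Rightarrow> 'a \<Rightarrow> ennreal) \<Rightarrow> 'a set set" where
  "closed_subsets X lam = {A. conv_closed X (conv_lim X lam) A}"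

definition rdc :: "'a set set set \<Rightarrow> 'a set set" where
  "rdc \<FF> = {\<Union>\<A> |\<A>. \<A> \<in> \<FF>}"

definition lK :: "'a set \<Rightarrow> ('a filter \<Rightarrow> 'a \<Rightarrow> ennreal) \<Rightarrow> 'a set filter \<Rightarrow> 'a set \<Rightarrow> ennreal" where
  "lK X lam \<FF> A =
    (let \<CC> = closed_subsets X lam
     in SUP x\<in>A. adh X lam (rdc (grill \<CC> (fsets \<CC> \<FF>))) x)"

end

theory Submission
  imports Defs
begin

text \<open>In a pre-approach space the filters converging to \<open>x\<close> within \<open>\<gamma>\<close> have a coarsest member
  \<open>N \<gamma> x\<close>, and a filter \<open>G\<close> on \<open>X\<close> meshes with \<open>rdc (\<FF>\<^sup>#)\<close> iff \<open>V\<^sup>- = {C. C \<inter> V \<noteq> \<emptyset>}\<close> belongs to \<open>\<FF>\<close>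
  for every \<open>V \<in> G\<close>, because \<open>\<FF>\<^sup>#\<^sup># = \<FF>\<close>. Up to arbitrarily small slack, \<open>\<lambda>\<^sub>l\<^sub>K \<FF> A \<le> \<gamma>\<close> therefore says
  that \<open>V\<^sup>- \<in> \<FF>\<close> for all \<open>x \<in> A\<close> and \<open>V \<in> N \<gamma> x\<close>, a condition stable under intersections
  of filters. For the triangle axiom, every \<open>V \<in> N \<gamma> x\<close> with \<open>\<delta> + \<epsilon> < \<gamma>\<close> has
  \<open>{y. V \<in> N \<epsilon> y} \<in> N \<delta> x\<close>; hence the sets \<open>V\<^sup>-\<close> with \<open>V \<in> N \<gamma> x\<close>, \<open>x \<in> A\<close>, generate together
  with \<open>\<AA>\<close> a proper filter as soon as \<open>A\<close> is within \<open>\<delta>\<close> of the \<open>\<epsilon>\<close>-enlargement of \<open>\<AA>\<close>.\<close>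

section \<open>Coarsest filters, hitting and meshing\<close>

definition nbhd :: "'a set \<Rightarrow> ('a filter \<Rightarrow> 'a \<Rightarrow> ennreal) \<Rightarrow> ennreal \<Rightarrow> 'a \<Rightarrow> 'a filter" where
  "nbhd X lam \<gamma> x = Sup {F \<in> filters_on X. lam F x \<le> \<gamma>}"

text \<open>The condition that \<open>V\<^sup>-\<close> belongs to \<FF> for all \<open>V\<close> in
  \<open>G\<close>, phrased with predicates so that no carrier set has to be carried along.\<close>

definition hits :: "'a set filter \<Rightarrow> 'a filter \<Rightarrow> bool" where
  "hits \<FF> G \<longleftrightarrow> (\<forall>P. eventually P G \<longrightarrow> eventually (\<lambda>A. \<exists>y\<in>A. P y) \<FF>)"

lemma hits_mono: "hits \<FF> G \<Longrightarrow> G' \<ge> G \<Longrightarrow> hits \<FF> G'"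
  unfolding hits_def by (meson filter_leD)

lemma hits_antimono: "hits \<FF> G \<Longrightarrow> \<GG> \<le> \<FF> \<Longrightarrow> hits \<GG> G"
  unfolding hits_def by (meson filter_leD)

lemma hits_Sup: "hits (Sup D) G \<longleftrightarrow> (\<forall>\<FF>\<in>D. hits \<FF> G)"
  by (auto simp: hits_def eventually_Sup)

lemma eventually_mem_filters_on: "F \<in> filters_on X \<Longrightarrow> eventually (\<lambda>x. x \<in> X) F"
  by (simp add: filters_on_def le_principal)

lemma principal_singleton_filters_on: "x \<in> X \<Longrightarrow> principal {x} \<in> filters_on X"
  by (simp add: filters_on_def principal_eq_bot_iff)

lemma Sup_filters_on:
  assumes "D \<noteq> {}" "D \<subseteq> filters_on X"
  shows "Sup D \<in> filters_on X"
proof -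
  obtain F where "F \<in> D" "F \<noteq> bot"
    using assms by (auto simp: filters_on_def)
  then have "Sup D \<noteq> bot"
    by (metis Sup_upper bot.extremum_uniqueI)
  then show ?thesis
    using assms by (auto simp: filters_on_def intro: Sup_least)
qed

lemma mesh_singleton:
  assumes "G \<in> filters_on X" "A \<subseteq> X"
  shows "mesh X (fsets X G) {A} \<longleftrightarrow> frequently (\<lambda>x. x \<in> A) G"
proof
  assume m: "mesh X (fsets X G) {A}"
  show "frequently (\<lambda>x. x \<in> A) G"
    unfolding frequently_def
  proof
    assume "eventually (\<lambda>x. x \<notin> A) G"
    with eventually_mem_filters_on[OF assms(1)] have "eventually (\<lambda>x. x \<in> X - A) G"
      by eventually_elim auto
    then have "X - A \<in> fsets X G"
      by (auto simp: fsets_def)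
    with m show False
      by (auto simp: mesh_def grill_def)
  qed
next
  assume f: "frequently (\<lambda>x. x \<in> A) G"
  have "A \<inter> V \<noteq> {}" if "eventually (\<lambda>x. x \<in> V) G" for V
    using frequently_ex[OF frequently_eventually_conj[OF f that]] by auto
  then show "mesh X (fsets X G) {A}"
    by (auto simp: mesh_def grill_def fsets_def)
qed

lemma mesh_rdc:
  "mesh X (fsets X G) (rdc \<AA>) \<longleftrightarrow> (\<forall>\<A>\<in>\<AA>. \<forall>V\<in>fsets X G. \<Union>\<A> \<inter> V \<noteq> {})"
proof -
  have "V \<subseteq> X" if "V \<in> fsets X G" for V
    using that by (simp add: fsets_def)
  then show ?thesis
    unfolding mesh_def grill_def rdc_def by blast
qed

lemma mesh_rdc_grill:
  assumes "\<FF> \<in> filters_on \<CC>" "\<CC> \<subseteq> Pow X" "G \<in> filters_on X"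
  shows "mesh X (fsets X G) (rdc (grill \<CC> (fsets \<CC> \<FF>))) \<longleftrightarrow> hits \<FF> G"
proof
  assume m: "mesh X (fsets X G) (rdc (grill \<CC> (fsets \<CC> \<FF>)))"
  show "hits \<FF> G"
    unfolding hits_def
  proof (intro allI impI)
    fix P assume P: "eventually P G"
    define V where "V = {x\<in>X. P x}"
    \<comment> \<open>The closed sets missing \<open>V\<close>: their union misses \<open>V\<close>,
      so meshing keeps \<A> out of the grill. Hence some member of \<FF> avoids \<A>, that is, all
      its elements meet \<open>V\<close>.\<close>
    define \<A> where "\<A> = {A\<in>\<CC>. A \<inter> V = {}}"
    have "V \<in> fsets X G"
      using eventually_conj[OF eventually_mem_filters_on[OF assms(3)] P]
      by (auto simp: fsets_def V_def)
    moreover have "\<Union>\<A> \<inter> V = {}"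
      by (auto simp: \<A>_def)
    ultimately have "\<A> \<notin> grill \<CC> (fsets \<CC> \<FF>)"
      using m unfolding mesh_rdc by blast
    then obtain \<B> where \<B>: "\<B> \<in> fsets \<CC> \<FF>" "\<B> \<inter> \<A> = {}"
      by (auto simp: grill_def \<A>_def)
    then have "eventually (\<lambda>A. A \<in> \<B>) \<FF>"
      by (simp add: fsets_def)
    then show "eventually (\<lambda>A. \<exists>y\<in>A. P y) \<FF>"
      by (rule eventually_mono) (use \<B> in \<open>auto simp: fsets_def \<A>_def V_def\<close>)
  qed
next
  assume h: "hits \<FF> G"
  have "\<Union>\<A> \<inter> V \<noteq> {}" if "\<A> \<in> grill \<CC> (fsets \<CC> \<FF>)" "V \<in> fsets X G" for \<A> V
  proof -
    have "eventually (\<lambda>A. \<exists>y\<in>A. y \<in> V) \<FF>"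
      using h that(2) by (auto simp: hits_def fsets_def)
    with eventually_mem_filters_on[OF assms(1)]
    have "eventually (\<lambda>A. A \<in> {A\<in>\<CC>. \<exists>y\<in>A. y \<in> V}) \<FF>"
      by eventually_elim auto
    then have "{A\<in>\<CC>. \<exists>y\<in>A. y \<in> V} \<in> fsets \<CC> \<FF>"
      by (auto simp: fsets_def)
    with that(1) have "{A\<in>\<CC>. \<exists>y\<in>A. y \<in> V} \<inter> \<A> \<noteq> {}"
      unfolding grill_def by blast
    then show ?thesis by blast
  qed
  then show "mesh X (fsets X G) (rdc (grill \<CC> (fsets \<CC> \<FF>)))"
    unfolding mesh_rdc by blast
qed

section \<open>Neighbourhood filters of an approach space\<close>

lemma
  assumes "pre_approach_space X lam" "x \<in> X"
  shows nbhd_filters_on: "nbhd X lam \<gamma> x \<in> filters_on X"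
    and lam_nbhd_le: "lam (nbhd X lam \<gamma> x) x \<le> \<gamma>"
proof -
  let ?D = "{F \<in> filters_on X. lam F x \<le> \<gamma>}"
  \<comment> \<open>The pre-approach axiom speaks of nonempty families only; the point filter has
    value 0 at \<open>x\<close> and so qualifies for every \<gamma>.\<close>
  have "principal {x} \<in> ?D"
    using assms by (auto simp: principal_singleton_filters_on pre_approach_space_def
        convergence_approach_space_def)
  then have D: "?D \<noteq> {}" "?D \<subseteq> filters_on X"
    by blast+
  then show "nbhd X lam \<gamma> x \<in> filters_on X"
    unfolding nbhd_def by (rule Sup_filters_on)
  have "lam (nbhd X lam \<gamma> x) x = (SUP F\<in>?D. lam F x)"
    unfolding nbhd_def using assms D by (simp add: pre_approach_space_def)
  also have "\<dots> \<le> \<gamma>"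
    by (rule SUP_least) simp
  finally show "lam (nbhd X lam \<gamma> x) x \<le> \<gamma>" .
qed

lemma le_nbhd: "F \<in> filters_on X \<Longrightarrow> lam F x \<le> \<gamma> \<Longrightarrow> F \<le> nbhd X lam \<gamma> x"
  by (auto simp: nbhd_def intro: Sup_upper)

lemma adh_singleton_le:
  assumes "pre_approach_space X lam" "x \<in> X" "A \<subseteq> X"
    "frequently (\<lambda>y. y \<in> A) (nbhd X lam \<gamma> x)"
  shows "adh X lam {A} x \<le> \<gamma>"
  unfolding adh_def
  by (rule INF_lower2[where i = "nbhd X lam \<gamma> x"])
    (use assms in \<open>simp_all add: nbhd_filters_on lam_nbhd_le mesh_singleton\<close>)

text \<open>The strict bound yields an actual meshing filter with value below \<gamma>. It is finer
  than \<open>nbhd X lam \<gamma> x\<close>, and meshing with \<open>A\<close> passes to coarser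
  filters.\<close>

lemma frequently_nbhd:
  assumes "A \<subseteq> X" "adh X lam {A} x < \<gamma>"
  shows "frequently (\<lambda>y. y \<in> A) (nbhd X lam \<gamma> x)"
proof -
  obtain G where G: "G \<in> filters_on X" "mesh X (fsets X G) {A}" "lam G x < \<gamma>"
    using assms(2) by (auto simp: adh_def INF_less_iff)
  then have "frequently (\<lambda>y. y \<in> A) G"
    using assms(1) by (simp add: mesh_singleton)
  moreover have "G \<le> nbhd X lam \<gamma> x"
    using G(1,3) by (intro le_nbhd) auto
  ultimately show ?thesis
    by (auto simp: frequently_def le_filter_def)
qed

text \<open>The triangle axiom of \<open>X\<close> in filter form. Where \<open>P\<close> is not an
  \<epsilon>-neighbourhood, the point lies in the \<epsilon>-enlargement of the complement
  \<open>A\<close> of \<open>P\<close>. If such points were frequent within \<delta> of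
  \<open>x\<close>, then \<open>A\<close> would have adherence below \<gamma> at \<open>x\<close>
  and so would mesh with a filter containing \<open>P\<close>.\<close>

lemma eventually_eventually_nbhd:
  assumes app: "approach_space X lam" and x: "x \<in> X"
    and P: "eventually P (nbhd X lam \<gamma> x)" and less: "\<delta> + \<epsilon> < \<gamma>"
  shows "eventually (\<lambda>y. eventually P (nbhd X lam \<epsilon> y)) (nbhd X lam \<delta> x)"
proof (rule ccontr)
  have pre: "pre_approach_space X lam"
    using app by (simp add: approach_space_def)
  define A where "A = {y\<in>X. \<not> P y}"
  have AX: "A \<subseteq> X" by (auto simp: A_def)
  have far: "y \<in> enlargement X lam A \<epsilon>" if y: "y \<in> X" "\<not> eventually P (nbhd X lam \<epsilon> y)" for y
  proof -
    have "frequently (\<lambda>z. z \<in> X \<and> \<not> P z) (nbhd X lam \<epsilon> y)"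
      using y by (intro frequently_eventually_conj eventually_mem_filters_on nbhd_filters_on pre)
        (simp add: frequently_def)
    then have "frequently (\<lambda>z. z \<in> A) (nbhd X lam \<epsilon> y)"
      by (rule frequently_elim1) (auto simp: A_def)
    then show ?thesis
      using adh_singleton_le[OF pre y(1) AX] y(1) by (simp add: enlargement_def)
  qed
  assume "\<not> ?thesis"
  then have "frequently (\<lambda>y. y \<in> X \<and> \<not> eventually P (nbhd X lam \<epsilon> y)) (nbhd X lam \<delta> x)"
    using x by (intro frequently_eventually_conj eventually_mem_filters_on nbhd_filters_on pre)
      (simp_all add: frequently_def)
  then have "frequently (\<lambda>y. y \<in> enlargement X lam A \<epsilon>) (nbhd X lam \<delta> x)"
    by (rule frequently_elim1) (use far in auto)
  then have "adh X lam {enlargement X lam A \<epsilon>} x \<le> \<delta>"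
    by (intro adh_singleton_le[OF pre x]) (auto simp: enlargement_def)
  moreover have "adh X lam {A} x \<le> adh X lam {enlargement X lam A \<epsilon>} x + \<epsilon>"
    using app AX x by (auto simp: approach_space_def)
  ultimately have "adh X lam {A} x < \<gamma>"
    using less by (meson add_right_mono le_less_trans order_trans)
  from frequently_ex[OF frequently_eventually_conj[OF frequently_nbhd[OF AX this] P]] show False
    by (auto simp: A_def)
qed

section \<open>Bounds on \<open>lK\<close> through neighbourhood filters\<close>

lemma closed_subsets_subset_Pow: "closed_subsets X lam \<subseteq> Pow X"
  by (auto simp: closed_subsets_def conv_closed_def)

lemma lK_eq:
  assumes "\<FF> \<in> filters_on (closed_subsets X lam)"
  shows "lK X lam \<FF> A = (SUP x\<in>A. INF G\<in>{G \<in> filters_on X. hits \<FF> G}. lam G x)"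
proof -
  have "{G \<in> filters_on X. mesh X (fsets X G)
      (rdc (grill (closed_subsets X lam) (fsets (closed_subsets X lam) \<FF>)))}
      = {G \<in> filters_on X. hits \<FF> G}"
    using mesh_rdc_grill[OF assms closed_subsets_subset_Pow] by blast
  then show ?thesis
    by (simp add: lK_def adh_def)
qed

lemma hits_nbhd_of_lK_less:
  assumes "\<FF> \<in> filters_on (closed_subsets X lam)" "lK X lam \<FF> A < \<gamma>" "x \<in> A"
  shows "hits \<FF> (nbhd X lam \<gamma> x)"
proof -
  have "(INF G\<in>{G \<in> filters_on X. hits \<FF> G}. lam G x) < \<gamma>"
    using assms(2) unfolding lK_eq[OF assms(1)] by (rule le_less_trans[OF SUP_upper[OF assms(3)]])
  then obtain G where "G \<in> filters_on X" "hits \<FF> G" "lam G x < \<gamma>"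
    by (auto simp: INF_less_iff)
  then show ?thesis
    by (meson hits_mono le_nbhd less_imp_le)
qed

text \<open>Converse to \<open>hits_nbhd_of_lK_less\<close> up to strictness; later arguments absorb
  that gap by density of the order or by a small extra summand.\<close>

lemma lK_le_of_hits_nbhd:
  assumes "pre_approach_space X lam" "\<FF> \<in> filters_on (closed_subsets X lam)" "A \<subseteq> X"
    "\<And>x. x \<in> A \<Longrightarrow> hits \<FF> (nbhd X lam \<gamma> x)"
  shows "lK X lam \<FF> A \<le> \<gamma>"
  unfolding lK_eq[OF assms(2)]
proof (rule SUP_least)
  fix x assume x: "x \<in> A"
  then have "nbhd X lam \<gamma> x \<in> {G \<in> filters_on X. hits \<FF> G}"
    using assms by (auto intro: nbhd_filters_on)
  then show "(INF G\<in>{G \<in> filters_on X. hits \<FF> G}. lam G x) \<le> \<gamma>"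
    by (rule INF_lower2) (use assms x in \<open>auto intro: lam_nbhd_le\<close>)
qed

lemma lK_mono:
  assumes "\<FF> \<in> filters_on (closed_subsets X lam)" "\<GG> \<in> filters_on (closed_subsets X lam)"
    "\<GG> \<le> \<FF>"
  shows "lK X lam \<GG> A \<le> lK X lam \<FF> A"
  unfolding lK_eq[OF assms(1)] lK_eq[OF assms(2)]
proof (rule SUP_mono')
  show "(INF G\<in>{G \<in> filters_on X. hits \<GG> G}. lam G x)
      \<le> (INF G\<in>{G \<in> filters_on X. hits \<FF> G}. lam G x)" for x
    by (rule INF_superset_mono) (auto intro: hits_antimono[OF _ assms(3)])
qed

section \<open>The pre-approach axioms for \<open>lK\<close>\<close>

lemma pre_approach_space_lK:
  assumes pre: "pre_approach_space X lam"
  shows "pre_approach_space (closed_subsets X lam) (lK X lam)"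
  unfolding pre_approach_space_def convergence_approach_space_def
proof (intro conjI ballI impI allI)
  let ?C = "closed_subsets X lam"
  show "lK X lam \<GG> A \<le> lK X lam \<FF> A"
    if "\<FF> \<in> filters_on ?C" "\<GG> \<in> filters_on ?C" "\<GG> \<le> \<FF>" for \<FF> \<GG> A
    using that by (rule lK_mono)
  show "lK X lam (principal {A}) A = 0" if A: "A \<in> ?C" for A
  proof -
    have AX: "A \<subseteq> X" using A closed_subsets_subset_Pow by blast
    have "lK X lam (principal {A}) A \<le> 0"
    proof (rule lK_le_of_hits_nbhd[OF pre principal_singleton_filters_on[OF A] AX])
      fix x assume x: "x \<in> A"
      then have "principal {x} \<le> nbhd X lam 0 x"
        using pre AX by (intro le_nbhd principal_singleton_filters_on)
          (auto simp: pre_approach_space_def convergence_approach_space_def)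
      moreover have "hits (principal {A}) (principal {x})"
        using x by (auto simp: hits_def eventually_principal)
      ultimately show "hits (principal {A}) (nbhd X lam 0 x)"
        by (rule hits_mono[rotated])
    qed
    then show ?thesis by simp
  qed
  show "lK X lam (Sup D) A = (SUP \<FF>\<in>D. lK X lam \<FF> A)"
    if D: "D \<noteq> {} \<and> D \<subseteq> filters_on ?C" and A: "A \<in> ?C" for D A
  proof (rule antisym)
    have Sup: "Sup D \<in> filters_on ?C"
      using D by (intro Sup_filters_on) auto
    show "(SUP \<FF>\<in>D. lK X lam \<FF> A) \<le> lK X lam (Sup D) A"
      using D by (intro SUP_least lK_mono Sup Sup_upper) auto
    show "lK X lam (Sup D) A \<le> (SUP \<FF>\<in>D. lK X lam \<FF> A)"
    \<comment> \<open>A bound strictly above the supremum makes one filter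
      \<open>nbhd X lam \<gamma> x\<close> hit by all members of \<open>D\<close> at once, hence by
      \<open>Sup D\<close>.\<close>
    proof (rule dense_ge)
      fix \<gamma> assume \<gamma>: "(SUP \<FF>\<in>D. lK X lam \<FF> A) < \<gamma>"
      have "hits \<FF> (nbhd X lam \<gamma> x)" if \<FF>: "\<FF> \<in> D" and x: "x \<in> A" for \<FF> x
      proof (rule hits_nbhd_of_lK_less[OF _ _ x])
        show "\<FF> \<in> filters_on ?C" using \<FF> D by blast
        show "lK X lam \<FF> A < \<gamma>" by (rule le_less_trans[OF SUP_upper[OF \<FF>] \<gamma>])
      qed
      then show "lK X lam (Sup D) A \<le> \<gamma>"
        using subsetD[OF closed_subsets_subset_Pow A]
        by (intro lK_le_of_hits_nbhd[OF pre Sup]) (auto simp: hits_Sup)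
    qed
  qed
qed

section \<open>The triangle axiom for \<open>lK\<close>\<close>

text \<open>The sets \<open>V\<^sup>-\<close> for \<open>V \<in> N \<gamma> x\<close> and \<open>x \<in> A\<close> generate a filter, and \<open>\<AA>\<close> meshes with it:
  any finitely many of the \<open>V\<^sup>-\<close> are met simultaneously by a member of \<open>\<AA>\<close>, found near a
  point \<open>B\<close> of the enlargement of \<open>\<AA>\<close>.\<close>

lemma adh_lK_le:
  assumes app: "approach_space X lam" and \<AA>: "\<AA> \<subseteq> closed_subsets X lam"
    and A: "A \<in> closed_subsets X lam"
    and less: "adh (closed_subsets X lam) (lK X lam)
        {enlargement (closed_subsets X lam) (lK X lam) \<AA> \<epsilon>} A < \<delta>"
      "\<epsilon> < \<epsilon>'" "\<delta> + \<epsilon>' < \<gamma>"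
  shows "adh (closed_subsets X lam) (lK X lam) {\<AA>} A \<le> \<gamma>"
proof -
  let ?C = "closed_subsets X lam"
  let ?E = "enlargement ?C (lK X lam) \<AA> \<epsilon>"
  have pre: "pre_approach_space X lam"
    using app by (simp add: approach_space_def)
  have AX: "A \<subseteq> X" using A closed_subsets_subset_Pow by blast
  obtain \<FF> where \<FF>: "\<FF> \<in> filters_on ?C" "mesh ?C (fsets ?C \<FF>) {?E}" "lK X lam \<FF> A < \<delta>"
    using less(1) by (subst (asm) adh_def) (auto simp: INF_less_iff)
  have freqE: "frequently (\<lambda>B. B \<in> ?E) \<FF>"
    using \<FF>(1,2) by (subst (asm) mesh_singleton) (auto simp: enlargement_def)
  define I where "I = {(x, P). x \<in> A \<and> eventually P (nbhd X lam \<gamma> x)}"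
  define \<GG> where "\<GG> = (INF (x, P)\<in>I. principal {B. \<exists>y\<in>B. P y})"
  define \<HH> where "\<HH> = inf \<GG> (principal \<AA>)"
  have "\<HH> \<noteq> bot"
  proof
    assume "\<HH> = bot"
    then have "eventually (\<lambda>B. False) \<HH>" by simp
    then have "eventually (\<lambda>B. B \<notin> \<AA>) \<GG>"
      by (simp add: \<HH>_def eventually_inf_principal)
    then obtain S where S: "S \<subseteq> I" "finite S"
        and "eventually (\<lambda>B. B \<notin> \<AA>) (INF (x, P)\<in>S. principal {B. \<exists>y\<in>B. P y})"
      unfolding \<GG>_def by (subst (asm) eventually_INF) auto
    then have none: "B \<notin> \<AA>" if "\<forall>(x, P)\<in>S. \<exists>y\<in>B. P y" for B
      using that by (auto simp: case_prod_unfold INF_principal_finite eventually_principal)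
    \<comment> \<open>First half of the triangle: \<FF> hits the \<delta>-neighbourhoods of
      \<open>x\<close>, and the points having \<open>P\<close> as an \<epsilon>'-neighbourhood form
      one of them.\<close>
    have "eventually (\<lambda>B. \<exists>y\<in>B. eventually (snd i) (nbhd X lam \<epsilon>' y)) \<FF>"
      if iI: "i \<in> I" for i
    proof -
      obtain x P where i: "i = (x, P)" "x \<in> A" "eventually P (nbhd X lam \<gamma> x)"
        using iI by (auto simp: I_def)
      then have "eventually (\<lambda>y. eventually P (nbhd X lam \<epsilon>' y)) (nbhd X lam \<delta> x)"
        using AX by (intro eventually_eventually_nbhd[OF app _ _ less(3)]) auto
      then show ?thesis
        using hits_nbhd_of_lK_less[OF \<FF>(1,3) i(2)] i(1) by (auto simp: hits_def)
    qed
    then have "eventually (\<lambda>B. \<forall>i\<in>S. \<exists>y\<in>B. eventually (snd i) (nbhd X lam \<epsilon>' y)) \<FF>"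
      using S by (intro eventually_ball_finite) blast+
    from frequently_ex[OF frequently_eventually_conj[OF freqE this]]
    obtain B where B: "B \<in> ?E" "\<forall>i\<in>S. \<exists>y\<in>B. eventually (snd i) (nbhd X lam \<epsilon>' y)"
      by auto
    \<comment> \<open>Membership in \<open>?E\<close> only bounds the infimum by \<epsilon>; the
      room up to \<epsilon>' provides an actual filter \<KK> below that value.\<close>
    have "adh ?C (lK X lam) {\<AA>} B < \<epsilon>'"
      using B(1) less(2) by (auto simp: enlargement_def)
    then obtain \<KK> where \<KK>: "\<KK> \<in> filters_on ?C" "mesh ?C (fsets ?C \<KK>) {\<AA>}" "lK X lam \<KK> B < \<epsilon>'"
      by (subst (asm) adh_def) (auto simp: INF_less_iff)
    have freqA: "frequently (\<lambda>B. B \<in> \<AA>) \<KK>"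
      using \<KK>(1,2) \<AA> by (simp add: mesh_singleton)
    \<comment> \<open>Second half: \<KK> hits the \<epsilon>'-neighbourhoods of each
      \<open>y\<close> in \<open>B\<close>. As \<KK> also meshes with \<AA>, some member of \<AA>
      meets all of the finitely many sets, against \<open>none\<close>.\<close>
    have "eventually (\<lambda>B'. \<exists>y\<in>B'. snd i y) \<KK>" if "i \<in> S" for i
      using B(2) that hits_nbhd_of_lK_less[OF \<KK>(1,3)] by (auto simp: hits_def)
    then have "eventually (\<lambda>B'. \<forall>i\<in>S. \<exists>y\<in>B'. snd i y) \<KK>"
      using S(2) by (simp add: eventually_ball_finite)
    from frequently_ex[OF frequently_eventually_conj[OF freqA this]] none show False
      by (auto simp: case_prod_unfold)
  qed
  moreover have le: "\<HH> \<le> principal \<AA>"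
    by (simp add: \<HH>_def)
  ultimately have \<HH>: "\<HH> \<in> filters_on ?C"
    using \<AA> by (auto simp: filters_on_def intro: order_trans)
  have "hits \<HH> (nbhd X lam \<gamma> x)" if "x \<in> A" for x
    unfolding hits_def
  proof (intro allI impI)
    fix P assume "eventually P (nbhd X lam \<gamma> x)"
    then have "(x, P) \<in> I"
      using that by (simp add: I_def)
    then have "\<GG> \<le> principal {B. \<exists>y\<in>B. P y}"
      unfolding \<GG>_def by (rule INF_lower2) simp
    then show "eventually (\<lambda>B. \<exists>y\<in>B. P y) \<HH>"
      by (simp add: \<HH>_def le_principal eventually_inf_principal eventually_mono)
  qed
  then have "lK X lam \<HH> A \<le> \<gamma>"
    by (rule lK_le_of_hits_nbhd[OF pre \<HH> AX])
  moreover have "frequently (\<lambda>B. B \<in> \<AA>) \<HH>"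
    using le \<open>\<HH> \<noteq> bot\<close> by (simp add: le_principal eventually_frequently)
  then have "mesh ?C (fsets ?C \<HH>) {\<AA>}"
    using \<HH> \<AA> by (simp add: mesh_singleton)
  ultimately show ?thesis
    using \<HH> unfolding adh_def by (auto intro: INF_lower2)
qed

theorem theorem27:
  fixes X :: "'a set" and lam :: "'a filter \<Rightarrow> 'a \<Rightarrow> ennreal"
  assumes "approach_space X lam"
  shows "approach_space (closed_subsets X lam) (lK X lam)"
  unfolding approach_space_def
proof (intro conjI allI impI ballI)
  let ?C = "closed_subsets X lam"
  show "pre_approach_space ?C (lK X lam)"
    using assms by (simp add: approach_space_def pre_approach_space_lK)
  fix \<AA> \<epsilon> A assume "\<AA> \<subseteq> ?C" "A \<in> ?C"
  define a where "a = adh ?C (lK X lam) {enlargement ?C (lK X lam) \<AA> \<epsilon>} A"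
  have "adh ?C (lK X lam) {\<AA>} A \<le> a + \<epsilon>"
  \<comment> \<open>Finiteness makes adding a positive amount strict. One third of \<open>e\<close>
    goes to \<delta>, one to \<epsilon>', and the last keeps their sum strictly below
    \<gamma>.\<close>
  proof (rule ennreal_le_epsilon)
    fix e :: real assume fin: "a + \<epsilon> < top" and e: "0 < e"
    have less: "a < a + ennreal (e / 3)" "\<epsilon> < \<epsilon> + ennreal (e / 3)"
      using fin e ennreal_add_left_cancel_less[of a 0] ennreal_add_left_cancel_less[of \<epsilon> 0]
      by (auto simp: less_top)
    have "a + ennreal (e / 3) + (\<epsilon> + ennreal (e / 3)) = a + \<epsilon> + ennreal (2 * e / 3)"
      using e by (simp add: ac_simps flip: ennreal_plus)
    also have "\<dots> < a + \<epsilon> + ennreal e"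
      using fin e by (auto simp: ennreal_add_left_cancel_less ennreal_less_iff)
    finally show "adh ?C (lK X lam) {\<AA>} A \<le> a + \<epsilon> + ennreal e"
      using adh_lK_le[OF assms \<open>\<AA> \<subseteq> ?C\<close> \<open>A \<in> ?C\<close>] less unfolding a_def by blast
  qed
  then show "adh ?C (lK X lam) {\<AA>} A \<le> adh ?C (lK X lam) {enlargement ?C (lK X lam) \<AA> \<epsilon>} A + \<epsilon>"
    by (simp add: a_def)
qed

end
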